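(* Let $v>r>2$ be integers such that a Steiner system $S(2,r,v)$ exists. If $k=\frac{v(v-1)}{r(r-1)}$ and $n$ is any positive integer divisible by $v$, then $M(k,n)\geq\frac{v}{r}(n-1)$.
   Context: A Steiner system $S(2,r,v)$ is a collection of $r$-element subsets (blocks) of a $v$-element set such that every pair of elements lies in exactly one block. For a finite graph $G$, $\mathrm{Mad}(G)=\max\{2e(H)/|V(H)| : H\subseteq G,\ |V(H)|\geq 1\}$. $M(k,n)$ is the maximum of $\sum_{i=1}^k\mathrm{Mad}(G_i)$ over all partitions of $E(K_n)$ into $k$ spanning subgraphs $G_1,\dots,G_k$. *)

theory Defs
  imports Complex_Main "HOL-Library.Disjoint_Sets" "HOL-Library.FuncSet"
begin

type_synonym 'a graph = "'a set \<times> 'a set set"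

abbreviation verts :: "'a graph \<Rightarrow> 'a set" where "verts \<equiv> fst"
abbreviation edges :: "'a graph \<Rightarrow> 'a set set" where "edges \<equiv> snd"

definition simple_graph :: "'a graph \<Rightarrow> bool" where
  "simple_graph G \<longleftrightarrow> edges G \<subseteq> {e. e \<subseteq> verts G \<and> card e = 2}"

definition subgraph :: "'a graph \<Rightarrow> 'a graph \<Rightarrow> bool" where
  "subgraph H G \<longleftrightarrow> simple_graph H \<and> verts H \<subseteq> verts G \<and> edges H \<subseteq> edges G"

definition spanning_subgraph :: "'a graph \<Rightarrow> 'a graph \<Rightarrow> bool" where
  "spanning_subgraph H G \<longleftrightarrow> subgraph H G \<and> verts H = verts G"

definition complete_graph :: "nat \<Rightarrow> nat graph" where
  "complete_graph n = ({1..n}, {e. e \<subseteq> {1..n} \<and> card e = 2})"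

definition Mad :: "'a graph \<Rightarrow> real" where
  "Mad G = Max {2 * real (card (edges H)) / real (card (verts H)) | H.
                  subgraph H G \<and> card (verts H) \<ge> 1}"

(* Individual parts of a partition may have no edges. *)
definition edge_partition :: "nat \<Rightarrow> 'a graph \<Rightarrow> (nat \<Rightarrow> 'a graph) \<Rightarrow> bool" where
  "edge_partition k K G \<longleftrightarrow>
     (\<forall>i\<in>{1..k}. spanning_subgraph (G i) K) \<and>
     disjoint_family_on (\<lambda>i. edges (G i)) {1..k} \<and>
     (\<Union>i\<in>{1..k}. edges (G i)) = edges K"

definition M :: "nat \<Rightarrow> nat \<Rightarrow> real" where
  "M k n = Max {(\<Sum>i=1..k. Mad (G i)) | G. edge_partition k (complete_graph n) G}"

definition steiner_system :: "nat \<Rightarrow> nat \<Rightarrow> 'a set \<Rightarrow> 'a set set \<Rightarrow> bool" where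
  "steiner_system r v X \<B> \<longleftrightarrow>
     finite X \<and> card X = v \<and>
     (\<forall>B\<in>\<B>. B \<subseteq> X \<and> card B = r) \<and>
     (\<forall>x\<in>X. \<forall>y\<in>X. x \<noteq> y \<longrightarrow> (\<exists>!B. B \<in> \<B> \<and> x \<in> B \<and> y \<in> B))"

text \<open>The sets whose maxima are taken above are finite and nonempty.\<close>

lemma finite_Mad_set:
  assumes "finite (verts G)"
  shows "finite {2 * real (card (edges H)) / real (card (verts H)) | H.
                  subgraph H G \<and> card (verts H) \<ge> 1}"
proof (rule finite_subset)
  show "{2 * real (card (edges H)) / real (card (verts H)) | H.
           subgraph H G \<and> card (verts H) \<ge> 1}
        \<subseteq> (\<lambda>H. 2 * real (card (edges H)) / real (card (verts H))) `
            (Pow (verts G) \<times> Pow (Pow (verts G)))"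
    by (fastforce simp: subgraph_def simple_graph_def)
qed (use assms in simp)

lemma nonempty_Mad_set:
  assumes "verts G \<noteq> {}"
  shows "{2 * real (card (edges H)) / real (card (verts H)) | H.
           subgraph H G \<and> card (verts H) \<ge> 1} \<noteq> {}"
proof -
  from assms obtain x where "x \<in> verts G" by blast
  then have "subgraph ({x}, {}) G \<and> card (verts ({x}, {} :: 'a set set)) \<ge> 1"
    by (simp add: subgraph_def simple_graph_def)
  then show ?thesis by blast
qed

lemma finite_M_set:
  "finite {(\<Sum>i=1..k. Mad (G i)) | G. edge_partition k (complete_graph n) G}"
proof (rule finite_subset)
  let ?S = "Pow {1..n} \<times> Pow (Pow {1..n})"
  show "{(\<Sum>i=1..k. Mad (G i)) | G. edge_partition k (complete_graph n) G}
        \<subseteq> (\<lambda>G. \<Sum>i=1..k. Mad (G i)) ` ({1..k} \<rightarrow>\<^sub>E ?S)"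
  proof
    fix s assume "s \<in> {(\<Sum>i=1..k. Mad (G i)) | G. edge_partition k (complete_graph n) G}"
    then obtain G where s: "s = (\<Sum>i=1..k. Mad (G i))"
      and G: "edge_partition k (complete_graph n) G" by blast
    have mem: "G i \<in> ?S" if "i \<in> {1..k}" for i
    proof -
      have "spanning_subgraph (G i) (complete_graph n)"
        using G that by (auto simp: edge_partition_def)
      then show ?thesis
        by (cases "G i") (auto simp: spanning_subgraph_def subgraph_def complete_graph_def)
    qed
    have "restrict G {1..k} \<in> {1..k} \<rightarrow>\<^sub>E ?S" using mem by (simp add: restrict_PiE_iff)
    moreover have "s = (\<Sum>i=1..k. Mad (restrict G {1..k} i))" unfolding s by simp
    ultimately show "s \<in> (\<lambda>G. \<Sum>i=1..k. Mad (G i)) ` ({1..k} \<rightarrow>\<^sub>E ?S)" by blast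
  qed
qed (simp add: finite_PiE)

lemma nonempty_M_set:
  assumes "k \<ge> 1"
  shows "{(\<Sum>i=1..k. Mad (G i)) | G. edge_partition k (complete_graph n) G} \<noteq> {}"
proof -
  define G where "G i = (if i = (1::nat) then complete_graph n else ({1..n}, {}))" for i
  have "edge_partition k (complete_graph n) G"
    using assms unfolding edge_partition_def G_def
    by (auto simp: spanning_subgraph_def subgraph_def simple_graph_def complete_graph_def
        disjoint_family_on_def subset_iff split: if_splits)
  then show ?thesis by blast
qed

end

theory Submission
  imports Defs
begin

text \<open>
  If \<open>k\<close> sets of at most \<open>s\<close> vertices each are such that every edge of \<open>K\<^sub>n\<close> lies inside one of
  them, give each edge to one such set, arbitrarily. A part with \<open>e\<close> edges has \<open>Mad \<ge> 2 * e / s\<close>,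
  and the numbers of edges add up to \<open>n * (n - 1) / 2\<close>, so the bounds add up to \<open>n * (n - 1) / s\<close>
  however the edges were assigned. For \<open>n = v * m\<close>, such sets of size \<open>r * m\<close> arise from the
  blocks of a Steiner system by blowing up every point to \<open>m\<close> vertices.
\<close>

definition all_edges :: "'a set \<Rightarrow> 'a set set" where
  "all_edges V = {e. e \<subseteq> V \<and> card e = 2}"

(* The case x = y is included on purpose: a map of vertices may identify the ends of an edge. *)
definition pair_cover :: "'a set \<Rightarrow> 'i set \<Rightarrow> ('i \<Rightarrow> 'a set) \<Rightarrow> bool" where
  "pair_cover V I W \<longleftrightarrow>
     (\<forall>i\<in>I. W i \<subseteq> V) \<and> (\<forall>x\<in>V. \<forall>y\<in>V. \<exists>i\<in>I. x \<in> W i \<and> y \<in> W i)"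

lemma finite_all_edges: "finite V \<Longrightarrow> finite (all_edges V)"
  by (simp add: all_edges_def)

lemma real_card_all_edges:
  assumes "finite V"
  shows "real (card (all_edges V)) = real (card V) * (real (card V) - 1) / 2"
  using assms
  by (simp add: all_edges_def n_subsets binomial_gbinomial gbinomial_prod_rev numeral_2_eq_2)

lemma simple_graph_iff_all_edges: "simple_graph G \<longleftrightarrow> edges G \<subseteq> all_edges (verts G)"
  by (simp add: simple_graph_def all_edges_def)

lemma complete_graph_eq_all_edges: "complete_graph n = ({1..n}, all_edges {1..n})"
  by (simp add: complete_graph_def all_edges_def)

lemma pair_cover_image_iff:
  "pair_cover V (f ` I) W \<longleftrightarrow> pair_cover V I (\<lambda>i. W (f i))"
  by (simp add: pair_cover_def)

lemma pair_cover_vimage: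
  assumes "pair_cover X I W" "f \<in> V \<rightarrow> X"
  shows "pair_cover V I (\<lambda>i. f -` W i \<inter> V)"
  using assms unfolding pair_cover_def by blast

lemma pair_cover_ex_superset:
  assumes "pair_cover V I W" "e \<in> all_edges V"
  shows "\<exists>i\<in>I. e \<subseteq> W i"
proof -
  obtain x y where e_eq: "e = {x, y}"
    using assms(2) by (auto simp: all_edges_def card_2_iff)
  then have "x \<in> V" "y \<in> V"
    using assms(2) by (auto simp: all_edges_def)
  then obtain i where "i \<in> I" "x \<in> W i" "y \<in> W i"
    using assms(1) unfolding pair_cover_def by blast
  then show ?thesis
    unfolding e_eq by blast
qed

lemma Mad_ge_subgraph:
  assumes "finite (verts G)" "subgraph H G" "verts H \<noteq> {}"
  shows "2 * real (card (edges H)) / real (card (verts H)) \<le> Mad G"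
proof -
  have "finite (verts H)"
    using assms(1,2) by (auto simp: subgraph_def intro: finite_subset)
  then have "card (verts H) \<ge> 1"
    using assms(3) by (simp add: Suc_leI card_gt_0_iff)
  then show ?thesis
    unfolding Mad_def using finite_Mad_set[OF assms(1)] assms(2) by (intro Max_ge) blast+
qed

lemma Mad_ge_edges_within:
  assumes "simple_graph G" "finite (verts G)"
    and "W \<subseteq> verts G" "W \<noteq> {}" "card W \<le> s" and "edges G \<subseteq> Pow W"
  shows "2 * real (card (edges G)) / real s \<le> Mad G"
proof -
  have "subgraph (W, edges G) G"
    using assms(1,3,6) by (auto simp: subgraph_def simple_graph_def)
  then have "2 * real (card (edges G)) / real (card W) \<le> Mad G"
    using Mad_ge_subgraph[of G "(W, edges G)"] assms(2,4) by simp
  moreover have "card W > 0"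
    using assms(2-4) by (simp add: card_gt_0_iff finite_subset)
  then have "2 * real (card (edges G)) / real s \<le> 2 * real (card (edges G)) / real (card W)"
    using assms(5) by (intro divide_left_mono) simp_all
  ultimately show ?thesis by linarith
qed

lemma sum_Mad_le_M:
  assumes "edge_partition k (complete_graph n) G"
  shows "(\<Sum>i=1..k. Mad (G i)) \<le> M k n"
  unfolding M_def using finite_M_set assms by (intro Max_ge) auto

lemma edge_partition_fibres:
  assumes "simple_graph K" "\<And>e. e \<in> edges K \<Longrightarrow> f e \<in> {1..k}"
  shows "edge_partition k K (\<lambda>i. (verts K, {e \<in> edges K. f e = i}))"
  using assms
  by (auto simp: edge_partition_def spanning_subgraph_def subgraph_def simple_graph_def
      disjoint_family_on_def)

lemma card_edges_edge_partition:
  assumes "edge_partition k K G" "finite (edges K)"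
  shows "card (edges K) = (\<Sum>i=1..k. card (edges (G i)))"
proof -
  have edges_eq: "edges K = (\<Union>i\<in>{1..k}. edges (G i))"
    and disjoint: "disjoint_family_on (\<lambda>i. edges (G i)) {1..k}"
    using assms(1) by (simp_all add: edge_partition_def)
  have "finite (edges (G i))" if "i \<in> {1..k}" for i
    using that assms(2) unfolding edges_eq by (auto intro: finite_subset[rotated])
  then show ?thesis
    unfolding edges_eq using disjoint by (intro card_UN_disjoint') auto
qed

lemma pair_cover_edge_partition:
  assumes "simple_graph K" "pair_cover (verts K) {1..k} W"
  obtains G where "edge_partition k K G" "\<And>i. i \<in> {1..k} \<Longrightarrow> edges (G i) \<subseteq> Pow (W i)"
proof -
  have "\<exists>i\<in>{1..k}. e \<subseteq> W i" if "e \<in> edges K" for e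
    using assms(1) that
    by (intro pair_cover_ex_superset[OF assms(2)]) (auto simp: simple_graph_iff_all_edges)
  then obtain f where f_within: "\<forall>e\<in>edges K. f e \<in> {1..k} \<and> e \<subseteq> W (f e)"
    by metis
  show thesis
  proof
    show "edge_partition k K (\<lambda>i. (verts K, {e \<in> edges K. f e = i}))"
      by (rule edge_partition_fibres[OF assms(1)]) (use f_within in blast)
    show "edges (verts K, {e \<in> edges K. f e = i}) \<subseteq> Pow (W i)" for i
      using f_within by auto
  qed
qed

lemma sum_Mad_ge_edges_within:
  assumes part: "edge_partition k K G" and "finite (verts K)"
    and W_bounds: "\<And>i. i \<in> {1..k} \<Longrightarrow> W i \<subseteq> verts K \<and> W i \<noteq> {} \<and> card (W i) \<le> s"
    and within: "\<And>i. i \<in> {1..k} \<Longrightarrow> edges (G i) \<subseteq> Pow (W i)"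
  shows "2 * real (card (edges K)) / real s \<le> (\<Sum>i=1..k. Mad (G i))"
proof -
  have spanning: "simple_graph (G i) \<and> verts (G i) = verts K" if "i \<in> {1..k}" for i
    using part that by (auto simp: edge_partition_def spanning_subgraph_def subgraph_def)
  have "edges K = (\<Union>i\<in>{1..k}. edges (G i))"
    using part by (simp add: edge_partition_def)
  also have "\<dots> \<subseteq> Pow (verts K)"
    using W_bounds within by blast
  finally have "finite (edges K)"
    using \<open>finite (verts K)\<close> by (simp add: finite_subset)
  then have "2 * real (card (edges K)) / real s
      = (\<Sum>i=1..k. 2 * real (card (edges (G i))) / real s)"
    by (simp add: card_edges_edge_partition[OF part] sum_divide_distrib sum_distrib_left)
  also have "\<dots> \<le> (\<Sum>i=1..k. Mad (G i))"
  proof (rule sum_mono)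
    show "2 * real (card (edges (G i))) / real s \<le> Mad (G i)" if "i \<in> {1..k}" for i
      using spanning[OF that] \<open>finite (verts K)\<close> W_bounds[OF that] within[OF that]
      by (intro Mad_ge_edges_within[of _ "W i"]) simp_all
  qed
  finally show ?thesis .
qed

lemma M_ge_pair_cover:
  assumes cover: "pair_cover {1..n} I W" and "finite I"
    and W_bounds: "\<And>i. i \<in> I \<Longrightarrow> W i \<noteq> {} \<and> card (W i) \<le> s"
  shows "real n * (real n - 1) / real s \<le> M (card I) n"
proof -
  let ?k = "card I" and ?K = "complete_graph n"
  have K_simps: "verts ?K = {1..n}" "edges ?K = all_edges {1..n}" "simple_graph ?K"
    by (simp_all add: complete_graph_eq_all_edges simple_graph_iff_all_edges)
  obtain b where image_b: "b ` {1..?k} = I"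
    using ex_bij_betw_nat_finite_1[OF \<open>finite I\<close>] bij_betw_imp_surj_on by metis
  then have "pair_cover (verts ?K) {1..?k} (\<lambda>i. W (b i))"
    using cover pair_cover_image_iff[of _ b "{1..?k}" W] by (simp only: K_simps image_b)
  then obtain G where part: "edge_partition ?k ?K G"
    and within: "\<And>i. i \<in> {1..?k} \<Longrightarrow> edges (G i) \<subseteq> Pow (W (b i))"
    using pair_cover_edge_partition[OF K_simps(3)] by blast
  have Wb_bounds: "W (b i) \<subseteq> verts ?K \<and> W (b i) \<noteq> {} \<and> card (W (b i)) \<le> s"
    if "i \<in> {1..?k}" for i
  proof -
    have "b i \<in> I" using image_b that by blast
    then show ?thesis using cover W_bounds by (simp add: pair_cover_def K_simps)
  qed
  have "real n * (real n - 1) / real s = 2 * real (card (edges ?K)) / real s"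
    by (simp add: K_simps real_card_all_edges)
  also have "\<dots> \<le> (\<Sum>i=1..?k. Mad (G i))"
    using sum_Mad_ge_edges_within[OF part _ Wb_bounds within] by (simp add: K_simps)
  also have "\<dots> \<le> M ?k n"
    by (rule sum_Mad_le_M[OF part])
  finally show ?thesis .
qed

lemma steiner_system_finite_blocks:
  assumes "steiner_system r v X \<B>"
  shows "finite \<B>"
proof (rule finite_subset)
  show "\<B> \<subseteq> Pow X" using assms by (auto simp: steiner_system_def)
  show "finite (Pow X)" using assms by (simp add: steiner_system_def)
qed

lemma steiner_system_ex1_block:
  assumes "steiner_system r v X \<B>" "e \<in> all_edges X"
  shows "\<exists>!B. B \<in> \<B> \<and> e \<in> all_edges B"
proof -
  obtain x y where "e = {x, y}" "x \<noteq> y"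
    using assms(2) by (auto simp: all_edges_def card_2_iff)
  then show ?thesis
    using assms by (auto simp: steiner_system_def all_edges_def)
qed

lemma steiner_system_UN_all_edges:
  assumes "steiner_system r v X \<B>"
  shows "(\<Union>B\<in>\<B>. all_edges B) = all_edges X"
proof
  show "(\<Union>B\<in>\<B>. all_edges B) \<subseteq> all_edges X"
    using assms by (auto simp: steiner_system_def all_edges_def)
  show "all_edges X \<subseteq> (\<Union>B\<in>\<B>. all_edges B)"
    using steiner_system_ex1_block[OF assms] by blast
qed

lemma steiner_system_disjoint_all_edges:
  assumes "steiner_system r v X \<B>"
  shows "disjoint_family_on all_edges \<B>"
proof -
  have "B = C" if "B \<in> \<B>" "C \<in> \<B>" "e \<in> all_edges B" "e \<in> all_edges C" for B C e
  proof -
    have "e \<in> all_edges X"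
      using that steiner_system_UN_all_edges[OF assms] by blast
    from steiner_system_ex1_block[OF assms this] show ?thesis
      using that by blast
  qed
  then show ?thesis
    unfolding disjoint_family_on_def by blast
qed

lemma steiner_system_card_blocks:
  assumes steiner: "steiner_system r v X \<B>" and "r \<ge> 2"
  shows "real (card \<B>) = real v * (real v - 1) / (real r * (real r - 1))"
proof -
  have X_card: "finite X" "card X = v"
    and block_card: "\<And>B. B \<in> \<B> \<Longrightarrow> finite B \<and> card B = r"
    using steiner by (auto simp: steiner_system_def intro: finite_subset)
  have "card (all_edges X) = (\<Sum>B\<in>\<B>. card (all_edges B))"
    unfolding steiner_system_UN_all_edges[OF steiner, symmetric]
    using steiner_system_disjoint_all_edges[OF steiner]
      steiner_system_finite_blocks[OF steiner] block_card
    by (intro card_UN_disjoint') (simp_all add: finite_all_edges)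
  then have "real (card (all_edges X)) = (\<Sum>B\<in>\<B>. real (card (all_edges B)))"
    by simp
  also have "\<dots> = real (card \<B>) * (real r * (real r - 1) / 2)"
    using block_card by (simp add: real_card_all_edges)
  finally have "real (card \<B>) * (real r * (real r - 1)) = real v * (real v - 1)"
    using X_card by (simp add: real_card_all_edges)
  then show ?thesis
    using \<open>r \<ge> 2\<close> by (intro eq_divide_imp) auto
qed

lemma steiner_system_pair_cover:
  assumes steiner: "steiner_system r v X \<B>" and "v \<ge> 2"
  shows "pair_cover X \<B> (\<lambda>B. B)"
proof -
  have ex_block: "\<exists>B\<in>\<B>. x \<in> B \<and> y \<in> B" if "x \<in> X" "y \<in> X" "x \<noteq> y" for x y
    using steiner that unfolding steiner_system_def by blast
  have "\<not> X \<subseteq> {x}" for x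
    using steiner \<open>v \<ge> 2\<close> card_mono[of "{x}" X] by (auto simp: steiner_system_def)
  then have "\<exists>y\<in>X. y \<noteq> x" for x
    by blast
  then have "\<exists>B\<in>\<B>. x \<in> B \<and> y \<in> B" if "x \<in> X" "y \<in> X" for x y
    using ex_block that by metis
  then show ?thesis
    using steiner by (simp add: pair_cover_def steiner_system_def)
qed

lemma ex_equitable_map:
  assumes "finite X" "finite V" "card V = card X * m"
  obtains c where "c \<in> V \<rightarrow> X" "\<And>B. B \<subseteq> X \<Longrightarrow> card (c -` B \<inter> V) = card B * m"
proof -
  have "card V = card (X \<times> {..<m})" by (simp add: assms card_cartesian_product)
  then obtain h where bij_h: "bij_betw h V (X \<times> {..<m})"
    using assms by (meson finite_SigmaI finite_lessThan finite_same_card_bij)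
  show thesis
  proof
    show "fst \<circ> h \<in> V \<rightarrow> X"
      using bij_betwE[OF bij_h] by fastforce
    fix B assume "B \<subseteq> X"
    have "h ` ((fst \<circ> h) -` B \<inter> V) = {p \<in> h ` V. fst p \<in> B}"
      by auto
    also have "\<dots> = B \<times> {..<m}"
      using \<open>B \<subseteq> X\<close> bij_betw_imp_surj_on[OF bij_h] by auto
    finally have "bij_betw h ((fst \<circ> h) -` B \<inter> V) (B \<times> {..<m})"
      by (intro bij_betw_subset[OF bij_h]) auto
    then show "card ((fst \<circ> h) -` B \<inter> V) = card B * m"
      by (simp add: bij_betw_same_card card_cartesian_product)
  qed
qed

theorem theorem6p8:
  fixes v r k n :: nat and X :: "'a set" and \<B> :: "'a set set"
  assumes "r > 2" and "v > r"
    and "steiner_system r v X \<B>"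
    and "real k = real v * (real v - 1) / (real r * (real r - 1))"
    and "n > 0" and "v dvd n"
  shows "M k n \<ge> real v / real r * (real n - 1)"
proof -
  obtain m where n_eq: "n = v * m" using \<open>v dvd n\<close> by blast
  have size_pos: "r * m > 0" using \<open>r > 2\<close> \<open>n > 0\<close> n_eq by simp
  have k_eq: "k = card \<B>"
    using steiner_system_card_blocks[OF assms(3)] assms(1,4) by simp
  obtain c where c_maps: "c \<in> {1..n} \<rightarrow> X"
    and card_vimage: "\<And>B. B \<subseteq> X \<Longrightarrow> card (c -` B \<inter> {1..n}) = card B * m"
    using ex_equitable_map[of X "{1..n}" m] assms(3) n_eq by (auto simp: steiner_system_def)
  have "pair_cover {1..n} \<B> (\<lambda>B. c -` B \<inter> {1..n})"
    using steiner_system_pair_cover[OF assms(3)] assms(1,2) c_maps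
    by (intro pair_cover_vimage) auto
  moreover have card_blow_up: "card (c -` B \<inter> {1..n}) = r * m" if "B \<in> \<B>" for B
    using card_vimage assms(3) that by (simp add: steiner_system_def)
  moreover have "c -` B \<inter> {1..n} \<noteq> {}" if "B \<in> \<B>" for B
    using card_blow_up[OF that] size_pos by (metis card.empty less_irrefl)
  ultimately have "real n * (real n - 1) / real (r * m) \<le> M k n"
    unfolding k_eq using steiner_system_finite_blocks[OF assms(3)]
    by (intro M_ge_pair_cover) auto
  also have "real n * (real n - 1) / real (r * m) = real v / real r * (real n - 1)"
    using size_pos by (simp add: n_eq)
  finally show ?thesis .
qed

end
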